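(* Let $Q$ be an abelian group and $\mathfrak{g}$ a $Q$-graded Lie algebra over an algebraically closed field $\Bbbk$. Let $W$ be a $Q$-graded simple module over $\mathfrak{g}$ with $\dim W<|\Bbbk|$. Then, for any fixed $\alpha\in Q$, any two degree $\alpha$ automorphisms of $W$ differ by a scalar factor only.
   Context: A $Q$-graded Lie algebra is a Lie algebra $\mathfrak{g}=\bigoplus_{\alpha\in Q}\mathfrak{g}_\alpha$ with $[\mathfrak{g}_\alpha,\mathfrak{g}_\beta]\subset\mathfrak{g}_{\alpha+\beta}$. A $Q$-graded $\mathfrak{g}$-module is a $\mathfrak{g}$-module $W=\bigoplus_{\alpha\in Q}W_\alpha$ with $\mathfrak{g}_\alpha W_\beta\subset W_{\alpha+\beta}$. It is graded simple if $\mathfrak{g}W\neq0$ and $W$ contains no non-trivial graded submodule (no graded submodule other than $0$ and $W$). A $\mathfrak{g}$-module homomorphism $\sigma:W\to W$ is homogeneous of degree $\alpha\in Q$ if $\sigma(W_\beta)\subset W_{\beta+\alpha}$ for all $\beta\in Q$; a degree $\alpha$ automorphism is a bijective $\mathfrak{g}$-module homomorphism $W\to W$ that is homogeneous of degree $\alpha$. The inequality $\dim W<|\Bbbk|$ is between cardinals. *)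

theory Defs
  imports "HOL-Computational_Algebra.Computational_Algebra"
begin

unbundle cardinal_syntax

section \<open>Dimension and direct sums\<close>

context vector_space
begin

text \<open>The library's \<^const>\<open>dim\<close> is a natural number and is 0 for infinite-dimensional
  spaces. Here the dimension is the cardinal of a basis, and it does not depend on the basis.\<close>

definition cdim :: "'b rel" where
  "cdim = |extend_basis {}|"

lemma cdim_eq_basis:
  assumes "independent B" "span B = UNIV"
  shows "|B| =o local.cdim"
proof -
  have "independent (extend_basis {})"
    by (rule independent_extend_basis) (rule independent_empty)
  moreover have "span (extend_basis {}) = UNIV"
    by (rule span_extend_basis) (rule independent_empty)
  ultimately obtain f where "bij_betw f B (extend_basis {})"
    using bij_if_span_eq_span_bases[of B "extend_basis {}"] assms by auto
  then show ?thesis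
    unfolding local.cdim_def using card_of_ordIso by blast
qed

text \<open>\<open>U\<close> is the internal direct sum of the subspaces \<open>A i\<close>: every element of \<open>U\<close> has exactly
  one expression as a finitely supported sum of elements of the \<open>A i\<close>.\<close>

definition is_direct_sum :: "('i \<Rightarrow> 'b set) \<Rightarrow> 'b set \<Rightarrow> bool" where
  "is_direct_sum A U \<longleftrightarrow>
     subspace U \<and> (\<forall>i. subspace (A i) \<and> A i \<subseteq> U) \<and>
     (\<forall>u\<in>U. \<exists>!f. (\<forall>i. f i \<in> A i) \<and> finite {i. f i \<noteq> 0} \<and> (\<Sum>i | f i \<noteq> 0. f i) = u)"

end


section \<open>Graded Lie algebras\<close>

locale lie_algebra = g: vector_space sg
  for sg :: "'k::field \<Rightarrow> 'g::ab_group_add \<Rightarrow> 'g" +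
  fixes bracket :: "'g \<Rightarrow> 'g \<Rightarrow> 'g"
  assumes bracket_linear_left: "Vector_Spaces.linear sg sg (\<lambda>x. bracket x y)"
    and bracket_linear_right: "Vector_Spaces.linear sg sg (bracket x)"
    and bracket_self: "bracket x x = 0"
    and jacobi: "bracket x (bracket y z) + bracket y (bracket z x) + bracket z (bracket x y) = 0"

locale graded_lie_algebra = lie_algebra sg bracket
  for sg :: "'k::field \<Rightarrow> 'g::ab_group_add \<Rightarrow> 'g"
    and bracket :: "'g \<Rightarrow> 'g \<Rightarrow> 'g" +
  fixes gg :: "'q::ab_group_add \<Rightarrow> 'g set"
  assumes algebra_direct_sum: "g.is_direct_sum gg UNIV"
    and bracket_graded: "x \<in> gg a \<Longrightarrow> y \<in> gg b \<Longrightarrow> bracket x y \<in> gg (a + b)"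


section \<open>Graded modules\<close>

locale lie_module = lie_algebra sg bracket + W: vector_space sw
  for sg :: "'k::field \<Rightarrow> 'g::ab_group_add \<Rightarrow> 'g"
    and bracket :: "'g \<Rightarrow> 'g \<Rightarrow> 'g"
    and sw :: "'k \<Rightarrow> 'w::ab_group_add \<Rightarrow> 'w" +
  fixes act :: "'g \<Rightarrow> 'w \<Rightarrow> 'w"
  assumes act_linear_left: "Vector_Spaces.linear sg sw (\<lambda>x. act x w)"
    and act_linear_right: "Vector_Spaces.linear sw sw (act x)"
    and act_bracket: "act (bracket x y) w = act x (act y w) - act y (act x w)"
begin

definition submodule :: "'w set \<Rightarrow> bool" where
  "submodule U \<longleftrightarrow> W.subspace U \<and> (\<forall>x. \<forall>u\<in>U. act x u \<in> U)"

definition module_endomorphism :: "('w \<Rightarrow> 'w) \<Rightarrow> bool" where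
  "module_endomorphism \<sigma> \<longleftrightarrow>
     Vector_Spaces.linear sw sw \<sigma> \<and> (\<forall>x w. \<sigma> (act x w) = act x (\<sigma> w))"

end

locale graded_lie_module =
  graded_lie_algebra sg bracket gg + lie_module sg bracket sw act
  for sg :: "'k::field \<Rightarrow> 'g::ab_group_add \<Rightarrow> 'g"
    and bracket :: "'g \<Rightarrow> 'g \<Rightarrow> 'g"
    and gg :: "'q::ab_group_add \<Rightarrow> 'g set"
    and sw :: "'k \<Rightarrow> 'w::ab_group_add \<Rightarrow> 'w"
    and act :: "'g \<Rightarrow> 'w \<Rightarrow> 'w" +
  fixes gw :: "'q \<Rightarrow> 'w set"
  assumes module_direct_sum: "W.is_direct_sum gw UNIV"
    and act_graded: "x \<in> gg a \<Longrightarrow> w \<in> gw b \<Longrightarrow> act x w \<in> gw (a + b)"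
begin

definition graded_submodule :: "'w set \<Rightarrow> bool" where
  "graded_submodule U \<longleftrightarrow> submodule U \<and> W.is_direct_sum (\<lambda>a. U \<inter> gw a) U"

definition graded_simple :: bool where
  "graded_simple \<longleftrightarrow>
     (\<exists>x w. act x w \<noteq> 0) \<and> (\<forall>U. graded_submodule U \<longrightarrow> U = {0} \<or> U = UNIV)"

definition homogeneous :: "'q \<Rightarrow> ('w \<Rightarrow> 'w) \<Rightarrow> bool" where
  "homogeneous a \<sigma> \<longleftrightarrow> (\<forall>b. \<sigma> ` gw b \<subseteq> gw (b + a))"

definition degree_automorphism :: "'q \<Rightarrow> ('w \<Rightarrow> 'w) \<Rightarrow> bool" where
  "degree_automorphism a \<sigma> \<longleftrightarrow> module_endomorphism \<sigma> \<and> bij \<sigma> \<and> homogeneous a \<sigma>"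

end

end

theory Submission
  imports Defs
begin

text \<open>
  The argument is the graded form of Schur's lemma combined with Amitsur's observation about
  operators on spaces of small dimension.

  For a scalar \<open>c\<close>, the map \<open>\<sigma> - c \<tau>\<close> is again a homogeneous endomorphism of degree \<open>\<alpha>\<close>. Kernel and
  image of a homogeneous endomorphism are graded submodules, so by graded simplicity such a map is
  zero or bijective (\<open>homogeneous_endomorphism_zero_or_bij\<close>). If it is zero for some \<open>c\<close>, then
  \<open>\<sigma> = c \<tau>\<close>. Otherwise all the maps \<open>\<sigma> - c \<tau>\<close> are bijective, and the linear operator
  \<open>\<theta> = \<tau>\<inverse> \<sigma>\<close> is such that \<open>\<theta> - c = \<tau>\<inverse> (\<sigma> - c \<tau>)\<close> is bijective for every scalar \<open>c\<close>.

  An operator \<open>\<theta>\<close> with this property cannot live on a nonzero space of dimension less than the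
  cardinality of the field (\<open>card_field_le_cdim\<close>). Over an algebraically closed field every nonzero
  polynomial \<open>p\<close> splits into linear factors, so \<open>p(\<theta>)\<close> is injective. Hence for \<open>w \<noteq> 0\<close> the vectors
  \<open>(\<theta> - c)\<inverse> w\<close>, with \<open>c\<close> ranging over the whole field, are distinct and linearly independent: they
  satisfy the same linear relations as the rational functions \<open>1 / (X - c)\<close>, because clearing
  denominators turns a relation into \<open>p(\<theta>) w = 0\<close> for a polynomial \<open>p\<close>.
\<close>

section \<open>Operators without eigenvalues\<close>

lemma (in vector_space) card_of_independent_le_cdim:
  assumes "independent B"
  shows "|B| \<le>o local.cdim"
proof -
  have "|B| \<le>o |extend_basis B|"
    using extend_basis_superset[OF assms] by (rule card_of_mono1)
  moreover have "|extend_basis B| =o local.cdim"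
    using independent_extend_basis[OF assms] span_extend_basis[OF assms] by (rule cdim_eq_basis)
  ultimately show ?thesis
    by (rule ordLeq_ordIso_trans)
qed

locale linear_operator = vector_space scale + T: Vector_Spaces.linear scale scale T
  for scale :: "'k::field \<Rightarrow> 'v::ab_group_add \<Rightarrow> 'v" (infixr "*s" 75)
    and T :: "'v \<Rightarrow> 'v"
begin

text \<open>This is \<open>p(T)\<close>, by Horner's scheme as in \<^const>\<open>poly\<close>.\<close>

definition poly_op :: "'k poly \<Rightarrow> 'v \<Rightarrow> 'v" where
  "poly_op p = fold_coeffs (\<lambda>a f w. a *s w + T (f w)) p (\<lambda>_. 0)"

lemma poly_op_0 [simp]: "poly_op 0 w = 0"
  by (simp add: poly_op_def)

lemma poly_op_pCons [simp]: "poly_op (pCons a p) w = a *s w + T (poly_op p w)"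
  by (cases "p = 0 \<and> a = 0") (auto simp: poly_op_def T.zero)

lemma poly_op_linear: "Vector_Spaces.linear scale scale (poly_op p)"
proof (induction p)
  case 0
  show ?case by unfold_locales (simp_all add: scale_right_distrib)
next
  case (pCons a p)
  interpret P: Vector_Spaces.linear scale scale "poly_op p" by (rule pCons.IH)
  show ?case
    by unfold_locales
      (simp_all add: P.add P.scale T.add T.scale scale_right_distrib scale_left_commute algebra_simps)
qed

lemma poly_op_add: "poly_op (p + q) w = poly_op p w + poly_op q w"
proof (induction p arbitrary: q)
  case (pCons a p)
  obtain b r where "q = pCons b r" by (cases q)
  then show ?case
    by (simp add: pCons.IH T.add scale_left_distrib algebra_simps)
qed simp

lemma poly_op_smult: "poly_op (smult a p) w = a *s poly_op p w"
  by (induction p) (simp_all add: T.scale scale_right_distrib)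

lemma poly_op_mult: "poly_op (p * q) w = poly_op p (poly_op q w)"
  by (induction p) (simp_all add: poly_op_add poly_op_smult)

lemma poly_op_sum: "poly_op (\<Sum>i\<in>I. p i) w = (\<Sum>i\<in>I. poly_op (p i) w)"
  by (induction I rule: infinite_finite_induct) (simp_all add: poly_op_add)

lemma poly_op_linear_factor: "poly_op [:- c, 1:] w = T w - c *s w"
  by (simp add: T.zero)

end

locale linear_operator_alg_closed = linear_operator scale T
  for scale :: "'k::alg_closed_field \<Rightarrow> 'v::ab_group_add \<Rightarrow> 'v" (infixr "*s" 75)
    and T :: "'v \<Rightarrow> 'v"
begin

text \<open>A nonconstant polynomial has a root, and splitting off the linear factor lowers the degree.\<close>

lemma poly_op_eq_0_imp:
  assumes no_eigenvalue: "\<And>c w. T w = c *s w \<Longrightarrow> w = 0"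
    and "p \<noteq> 0" and "poly_op p w = 0"
  shows "w = 0"
  using assms(2,3)
proof (induction "degree p" arbitrary: p)
  case 0
  then obtain a where "p = [:a:]" by (metis degree_eq_zeroE)
  with 0 show ?case by (simp add: T.zero)
next
  case (Suc n)
  then obtain c where "poly p c = 0"
    using alg_closed_imp_poly_has_root[of p] by auto
  then obtain q where p: "p = [:- c, 1:] * q"
    by (auto simp: poly_eq_0_iff_dvd elim: dvdE)
  with Suc.prems have "q \<noteq> 0" by auto
  have "degree p = degree [:- c, 1:] + degree q"
    unfolding p using \<open>q \<noteq> 0\<close> by (intro degree_mult_eq) auto
  with Suc.hyps have "n = degree q" by simp
  have "poly_op [:- c, 1:] (poly_op q w) = 0"
    using Suc.prems(2) by (simp only: p poly_op_mult)
  then have "T (poly_op q w) = c *s poly_op q w"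
    unfolding poly_op_linear_factor by simp
  then have "poly_op q w = 0" by (rule no_eigenvalue)
  with \<open>n = degree q\<close> \<open>q \<noteq> 0\<close> show ?case by (rule Suc.hyps(1))
qed

text \<open>The vectors \<open>v c\<close> play the role of \<open>(T - c)\<inverse> w\<close>. Applying the product of the factors \<open>T - d\<close> for
  all \<open>d\<close> in \<open>F\<close> clears the denominators in a linear relation over \<open>F\<close>. The polynomial obtained takes
  the value \<open>u c \<Prod>(c - d)\<close> at \<open>c\<close>, as in Lagrange interpolation, so it vanishes only if all
  coefficients \<open>u c\<close> do.\<close>

lemma resolvent_coefficients_zero:
  assumes no_eigenvalue: "\<And>c w. T w = c *s w \<Longrightarrow> w = 0"
    and resolvent: "\<And>c. T (v c) - c *s v c = w"
    and "w \<noteq> 0" and "finite F" and relation: "(\<Sum>c\<in>F. u c *s v c) = 0" and "c \<in> F"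
  shows "u c = 0"
proof -
  define lin where "lin d = [:- d, 1:]" for d :: 'k
  define p where "p = (\<Sum>d\<in>F. smult (u d) (\<Prod>e\<in>F - {d}. lin e))"
  interpret P: Vector_Spaces.linear scale scale "poly_op (prod lin F)"
    by (rule poly_op_linear)
  have clear: "poly_op (prod lin F) (v d) = poly_op (\<Prod>e\<in>F - {d}. lin e) w" if "d \<in> F" for d
  proof -
    have "prod lin F = (\<Prod>e\<in>F - {d}. lin e) * lin d"
      using \<open>finite F\<close> that by (simp add: prod.remove mult.commute)
    then show ?thesis
      by (simp only: poly_op_mult lin_def poly_op_linear_factor resolvent)
  qed
  have "poly_op p w = (\<Sum>d\<in>F. u d *s poly_op (prod lin F) (v d))"
    by (simp add: p_def poly_op_sum poly_op_smult clear)
  also have "\<dots> = poly_op (prod lin F) (\<Sum>d\<in>F. u d *s v d)"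
    by (simp add: P.sum P.scale)
  also have "\<dots> = 0"
    by (simp add: relation P.zero)
  finally have "p = 0"
    using poly_op_eq_0_imp[of p w] no_eigenvalue \<open>w \<noteq> 0\<close> by blast
  have "poly p c = (\<Sum>d\<in>F. if d = c then u c * (\<Prod>e\<in>F - {c}. c - e) else 0)"
    unfolding p_def poly_sum
  proof (rule sum.cong[OF refl])
    fix d assume "d \<in> F"
    have "(\<Prod>e\<in>F - {d}. c - e) = 0" if "d \<noteq> c"
      using \<open>finite F\<close> \<open>c \<in> F\<close> that by (auto simp: prod_zero_iff)
    then show "poly (smult (u d) (\<Prod>e\<in>F - {d}. lin e)) c
        = (if d = c then u c * (\<Prod>e\<in>F - {c}. c - e) else 0)"
      by (simp add: poly_prod lin_def)
  qed
  also have "\<dots> = u c * (\<Prod>e\<in>F - {c}. c - e)"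
    using \<open>finite F\<close> \<open>c \<in> F\<close> by simp
  finally have "u c * (\<Prod>e\<in>F - {c}. c - e) = 0"
    by (simp add: \<open>p = 0\<close>)
  moreover have "(\<Prod>e\<in>F - {c}. c - e) \<noteq> 0"
    using \<open>finite F\<close> by (auto simp: prod_zero_iff)
  ultimately show ?thesis by simp
qed

lemma card_field_le_cdim:
  fixes w :: 'v
  assumes bij: "\<And>c. bij (\<lambda>x. T x - c *s x)" and "w \<noteq> 0"
  shows "|UNIV :: 'k set| \<le>o local.cdim"
proof -
  have no_eigenvalue: "x = 0" if "T x = c *s x" for c x
  proof -
    have "T x - c *s x = T 0 - c *s 0"
      using that by (simp add: T.zero)
    then show ?thesis
      using injD[OF bij_is_inj[OF bij]] by blast
  qed
  have "\<exists>x. T x - c *s x = w" for c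
    using surjD[OF bij_is_surj[OF bij[of c]], of w] by auto
  then obtain v where v: "\<And>c. T (v c) - c *s v c = w" by metis
  have "inj v"
  proof (rule injI)
    fix c d assume eq: "v c = v d"
    \<comment> \<open>Both \<open>T - c\<close> and \<open>T - d\<close> send this vector to \<open>w\<close>, so \<open>c - d\<close> annihilates it.\<close>
    have "(c - d) *s v c = 0"
      using v[of c] v[of d] unfolding eq scale_left_diff_distrib by (simp add: algebra_simps)
    moreover have "v c \<noteq> 0"
      using v[of c] \<open>w \<noteq> 0\<close> by (auto simp: T.zero)
    ultimately show "c = d" by simp
  qed
  have "independent (range v)"
    unfolding independent_explicit_finite_subsets
  proof (intro allI impI ballI)
    fix S u x
    assume "S \<subseteq> range v" "finite S" "(\<Sum>y\<in>S. u y *s y) = 0" "x \<in> S"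
    have S: "S = v ` (v -` S)"
      using \<open>S \<subseteq> range v\<close> by auto
    have "(\<Sum>c\<in>v -` S. u (v c) *s v c) = (\<Sum>y\<in>v ` (v -` S). u y *s y)"
      using \<open>inj v\<close> by (subst sum.reindex) (auto intro: inj_on_subset)
    then have "(\<Sum>c\<in>v -` S. u (v c) *s v c) = 0"
      using \<open>(\<Sum>y\<in>S. u y *s y) = 0\<close> S by metis
    moreover have "finite (v -` S)"
      using \<open>finite S\<close> \<open>inj v\<close> by (rule finite_vimageI)
    moreover obtain c where c: "x = v c" "c \<in> v -` S"
      using \<open>x \<in> S\<close> \<open>S \<subseteq> range v\<close> by auto
    ultimately have "u (v c) = 0"
      using no_eigenvalue v \<open>w \<noteq> 0\<close>
      by (intro resolvent_coefficients_zero[where v = v and w = w and F = "v -` S"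
            and u = "\<lambda>c. u (v c)"]) auto
    with c show "u x = 0" by simp
  qed
  then have "|range v| \<le>o local.cdim"
    by (rule card_of_independent_le_cdim)
  moreover have "|UNIV :: 'k set| \<le>o |range v|"
    using \<open>inj v\<close> by (intro card_of_ordLeqI[of v]) auto
  ultimately show ?thesis
    using ordLeq_transitive by blast
qed

end


section \<open>Schur's lemma for graded simple modules\<close>

context graded_lie_module
begin

lemma subspace_gw: "W.subspace (gw b)"
  using module_direct_sum by (auto simp: W.is_direct_sum_def)

lemma decomposition_exists:
  obtains f where "\<And>b. f b \<in> gw b" "finite {b. f b \<noteq> 0}" "(\<Sum>b | f b \<noteq> 0. f b) = w"
  using module_direct_sum unfolding W.is_direct_sum_def by blast

lemma decomposition_unique:
  assumes "\<And>b. f b \<in> gw b" "finite {b. f b \<noteq> 0}"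
    and "\<And>b. g b \<in> gw b" "finite {b. g b \<noteq> 0}"
    and "(\<Sum>b | f b \<noteq> 0. f b) = (\<Sum>b | g b \<noteq> 0. g b)"
  shows "f = g"
  using module_direct_sum assms unfolding W.is_direct_sum_def by (metis UNIV_I)

text \<open>Uniqueness of the decomposition is inherited from the whole module, so that only existence of
  a decomposition inside \<open>U\<close> is at stake.\<close>

lemma graded_submoduleI:
  assumes "submodule U"
    and ex: "\<And>u. u \<in> U \<Longrightarrow>
      \<exists>f. (\<forall>b. f b \<in> U \<inter> gw b) \<and> finite {b. f b \<noteq> 0} \<and> (\<Sum>b | f b \<noteq> 0. f b) = u"
  shows "graded_submodule U"
proof -
  have "W.subspace U" using assms(1) by (simp add: submodule_def)
  moreover have "\<exists>!f. (\<forall>b. f b \<in> U \<inter> gw b) \<and> finite {b. f b \<noteq> 0} \<and> (\<Sum>b | f b \<noteq> 0. f b) = u"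
    if u: "u \<in> U" for u
    using ex[OF u] by (rule ex_ex1I) (rule decomposition_unique, auto)
  ultimately show ?thesis
    using assms(1) subspace_gw
    by (auto simp: graded_submodule_def W.is_direct_sum_def intro!: W.subspace_inter)
qed

lemma
  assumes "module_endomorphism \<phi>"
  shows submodule_kernel: "submodule {w. \<phi> w = 0}"
    and submodule_range: "submodule (range \<phi>)"
proof -
  interpret \<phi>: Vector_Spaces.linear sw sw \<phi>
    using assms by (simp add: module_endomorphism_def)
  have act: "\<phi> (act x w) = act x (\<phi> w)" for x w
    using assms by (simp add: module_endomorphism_def)
  have "act x 0 = 0" for x
  proof -
    interpret A: Vector_Spaces.linear sw sw "act x" by (rule act_linear_right)
    show ?thesis by (rule A.zero)
  qed
  then show "submodule {w. \<phi> w = 0}"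
    using \<phi>.subspace_kernel by (auto simp: submodule_def act)
  show "submodule (range \<phi>)"
    using \<phi>.subspace_image[OF W.subspace_UNIV] by (auto simp: submodule_def act[symmetric])
qed

text \<open>The image under a homogeneous map of a decomposition is a decomposition again, after shifting
  the degrees.\<close>

lemma homogeneous_decomposition:
  assumes lin: "Vector_Spaces.linear sw sw \<phi>" and hom: "homogeneous a \<phi>"
    and f: "\<And>b. f b \<in> gw b" "finite {b. f b \<noteq> 0}" "(\<Sum>b | f b \<noteq> 0. f b) = w"
  shows "\<phi> (f (b - a)) \<in> gw b"
    and "finite {b. \<phi> (f (b - a)) \<noteq> 0}"
    and "(\<Sum>b | \<phi> (f (b - a)) \<noteq> 0. \<phi> (f (b - a))) = \<phi> w"
proof -
  interpret \<phi>: Vector_Spaces.linear sw sw \<phi> by (rule lin)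
  show "\<phi> (f (b - a)) \<in> gw b"
    using hom f(1)[of "b - a"] unfolding homogeneous_def by (metis diff_add_cancel image_subset_iff)
  have sub: "{b. \<phi> (f (b - a)) \<noteq> 0} \<subseteq> (\<lambda>b. b + a) ` {b. f b \<noteq> 0}"
  proof
    fix b assume "b \<in> {b. \<phi> (f (b - a)) \<noteq> 0}"
    then have "b - a \<in> {b. f b \<noteq> 0}" by (auto simp: \<phi>.zero)
    then have "b - a + a \<in> (\<lambda>b. b + a) ` {b. f b \<noteq> 0}" by (rule imageI)
    then show "b \<in> (\<lambda>b. b + a) ` {b. f b \<noteq> 0}" by simp
  qed
  then show "finite {b. \<phi> (f (b - a)) \<noteq> 0}"
    using f(2) by (blast intro: finite_subset)
  have "(\<Sum>b | \<phi> (f (b - a)) \<noteq> 0. \<phi> (f (b - a)))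
      = (\<Sum>b\<in>(\<lambda>b. b + a) ` {b. f b \<noteq> 0}. \<phi> (f (b - a)))"
    using sub f(2) by (intro sum.mono_neutral_left) auto
  also have "\<dots> = (\<Sum>b | f b \<noteq> 0. \<phi> (f b))"
    by (subst sum.reindex) (auto simp: inj_on_def)
  also have "\<dots> = \<phi> w"
    using f(3) by (simp add: \<phi>.sum[symmetric])
  finally show "(\<Sum>b | \<phi> (f (b - a)) \<noteq> 0. \<phi> (f (b - a))) = \<phi> w" .
qed

lemma graded_submodule_kernel:
  assumes endo: "module_endomorphism \<phi>" and hom: "homogeneous a \<phi>"
  shows "graded_submodule {w. \<phi> w = 0}"
proof (rule graded_submoduleI)
  show "submodule {w. \<phi> w = 0}" using endo by (rule submodule_kernel)
next
  have lin: "Vector_Spaces.linear sw sw \<phi>" using endo by (simp add: module_endomorphism_def)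
  fix u assume "u \<in> {w. \<phi> w = 0}"
  then have "\<phi> u = 0" by simp
  obtain f where f: "\<And>b. f b \<in> gw b" "finite {b. f b \<noteq> 0}" "(\<Sum>b | f b \<noteq> 0. f b) = u"
    using decomposition_exists[of u] by metis
  \<comment> \<open>The shifted images of the components of \<open>u\<close> decompose \<open>\<phi> u = 0\<close>, so they are all zero.\<close>
  have "(\<lambda>b. \<phi> (f (b - a))) = (\<lambda>b. 0)"
    using homogeneous_decomposition[OF lin hom f] \<open>\<phi> u = 0\<close> subspace_gw
    by (intro decomposition_unique) (auto simp: W.subspace_0)
  then have "\<phi> (f b) = 0" for b
    by (metis add_diff_cancel)
  with f show "\<exists>f. (\<forall>b. f b \<in> {w. \<phi> w = 0} \<inter> gw b) \<and> finite {b. f b \<noteq> 0} \<and>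
      (\<Sum>b | f b \<noteq> 0. f b) = u"
    by (intro exI[of _ f]) auto
qed

lemma graded_submodule_range:
  assumes endo: "module_endomorphism \<phi>" and hom: "homogeneous a \<phi>"
  shows "graded_submodule (range \<phi>)"
proof (rule graded_submoduleI)
  show "submodule (range \<phi>)" using endo by (rule submodule_range)
next
  have lin: "Vector_Spaces.linear sw sw \<phi>" using endo by (simp add: module_endomorphism_def)
  fix u assume "u \<in> range \<phi>"
  then obtain w where w: "u = \<phi> w" by auto
  obtain f where f: "\<And>b. f b \<in> gw b" "finite {b. f b \<noteq> 0}" "(\<Sum>b | f b \<noteq> 0. f b) = w"
    using decomposition_exists[of w] by metis
  show "\<exists>f. (\<forall>b. f b \<in> range \<phi> \<inter> gw b) \<and> finite {b. f b \<noteq> 0} \<and> (\<Sum>b | f b \<noteq> 0. f b) = u"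
    using homogeneous_decomposition[OF lin hom f] w
    by (intro exI[of _ "\<lambda>b. \<phi> (f (b - a))"]) auto
qed

lemma homogeneous_endomorphism_zero_or_bij:
  assumes simple: graded_simple
    and endo: "module_endomorphism \<phi>" and hom: "homogeneous a \<phi>"
  shows "(\<forall>w. \<phi> w = 0) \<or> bij \<phi>"
proof (rule disjCI)
  assume not_bij: "\<not> bij \<phi>"
  interpret \<phi>: Vector_Spaces.linear sw sw \<phi>
    using endo by (simp add: module_endomorphism_def)
  have trivial: "U = {0} \<or> U = UNIV" if "graded_submodule U" for U
    using simple that by (simp add: graded_simple_def)
  show "\<forall>w. \<phi> w = 0"
  proof (rule ccontr)
    assume nonzero: "\<not> (\<forall>w. \<phi> w = 0)"
    then have "{w. \<phi> w = 0} = {0}"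
      using trivial[OF graded_submodule_kernel[OF endo hom]] by auto
    then have "inj \<phi>"
      by (auto simp: \<phi>.inj_iff_eq_0)
    moreover have "surj \<phi>"
      using trivial[OF graded_submodule_range[OF endo hom]] nonzero by blast
    ultimately show False
      using not_bij by (simp add: bij_def)
  qed
qed

lemma homogeneous_endomorphism_diff_scale:
  assumes "module_endomorphism \<sigma>" "homogeneous a \<sigma>"
    and "module_endomorphism \<tau>" "homogeneous a \<tau>"
  shows "module_endomorphism (\<lambda>w. \<sigma> w - sw c (\<tau> w))"
    and "homogeneous a (\<lambda>w. \<sigma> w - sw c (\<tau> w))"
proof -
  interpret \<sigma>: Vector_Spaces.linear sw sw \<sigma>
    using assms by (simp add: module_endomorphism_def)
  interpret \<tau>: Vector_Spaces.linear sw sw \<tau>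
    using assms by (simp add: module_endomorphism_def)
  have "Vector_Spaces.linear sw sw (\<lambda>w. \<sigma> w - sw c (\<tau> w))"
    by unfold_locales
      (simp_all add: \<sigma>.add \<sigma>.scale \<tau>.add \<tau>.scale W.scale_right_distrib
        W.scale_right_diff_distrib W.scale_left_commute)
  moreover have "\<sigma> (act x w) - sw c (\<tau> (act x w)) = act x (\<sigma> w - sw c (\<tau> w))" for x w
  proof -
    interpret A: Vector_Spaces.linear sw sw "act x" by (rule act_linear_right)
    show ?thesis using assms by (simp add: module_endomorphism_def A.diff A.scale)
  qed
  ultimately show "module_endomorphism (\<lambda>w. \<sigma> w - sw c (\<tau> w))"
    by (simp add: module_endomorphism_def)
  show "homogeneous a (\<lambda>w. \<sigma> w - sw c (\<tau> w))"
    using assms subspace_gw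
    by (auto simp: homogeneous_def image_subset_iff intro!: W.subspace_diff W.subspace_scale)
qed

end


section \<open>Uniqueness up to a scalar\<close>

theorem theorem14:
  fixes sg :: "'k::alg_closed_field \<Rightarrow> 'g::ab_group_add \<Rightarrow> 'g"
    and bracket :: "'g \<Rightarrow> 'g \<Rightarrow> 'g"
    and gg :: "'q::ab_group_add \<Rightarrow> 'g set"
    and sw :: "'k \<Rightarrow> 'w::ab_group_add \<Rightarrow> 'w"
    and act :: "'g \<Rightarrow> 'w \<Rightarrow> 'w"
    and gw :: "'q \<Rightarrow> 'w set"
    and \<alpha> :: 'q
    and \<sigma> \<tau> :: "'w \<Rightarrow> 'w"
  assumes "graded_lie_module sg bracket gg sw act gw"
    and "graded_lie_module.graded_simple sw act gw"
    and "vector_space.cdim sw <o |UNIV :: 'k set|"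
    and "graded_lie_module.degree_automorphism sw act gw \<alpha> \<sigma>"
    and "graded_lie_module.degree_automorphism sw act gw \<alpha> \<tau>"
  shows "\<exists>c. \<forall>w. \<sigma> w = sw c (\<tau> w)"
proof -
  interpret graded_lie_module sg bracket gg sw act gw by (rule assms(1))
  have \<sigma>: "module_endomorphism \<sigma>" "homogeneous \<alpha> \<sigma>"
    and \<tau>: "module_endomorphism \<tau>" "bij \<tau>" "homogeneous \<alpha> \<tau>"
    using assms(4,5) by (auto simp: degree_automorphism_def)
  interpret \<sigma>: Vector_Spaces.linear sw sw \<sigma>
    using \<sigma>(1) by (simp add: module_endomorphism_def)
  interpret \<tau>: Vector_Spaces.linear sw sw \<tau>
    using \<tau>(1) by (simp add: module_endomorphism_def)
  show ?thesis
  proof (rule ccontr)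
    assume "\<not> ?thesis"
    then have bij_diff: "bij (\<lambda>w. \<sigma> w - sw c (\<tau> w))" for c
      using homogeneous_endomorphism_zero_or_bij[OF assms(2)
          homogeneous_endomorphism_diff_scale[OF \<sigma> \<tau>(1,3), of c]]
      by (metis eq_iff_diff_eq_0)
    interpret pair: vector_space_pair sw sw ..
    obtain \<rho> where \<rho>: "Vector_Spaces.linear sw sw \<rho>" "\<rho> \<circ> \<tau> = id"
      using pair.linear_injective_left_inverse \<tau>.linear_axioms bij_is_inj[OF \<tau>(2)] by blast
    have "bij \<rho>"
      using \<rho>(2) \<tau>(2) by (metis bij_betw_comp_iff bij_id)
    interpret \<rho>: Vector_Spaces.linear sw sw \<rho> by (rule \<rho>(1))
    interpret \<theta>: linear_operator_alg_closed sw "\<lambda>w. \<rho> (\<sigma> w)"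
      by unfold_locales (simp_all add: \<rho>.add \<rho>.scale \<sigma>.add \<sigma>.scale)
    have "bij (\<lambda>w. \<rho> (\<sigma> w) - sw c w)" for c
    proof -
      have "(\<lambda>w. \<rho> (\<sigma> w) - sw c w) = \<rho> \<circ> (\<lambda>w. \<sigma> w - sw c (\<tau> w))"
        using \<rho>(2) by (auto simp: fun_eq_iff \<rho>.diff \<rho>.scale)
      then show ?thesis
        using bij_comp[OF bij_diff \<open>bij \<rho>\<close>] by simp
    qed
    moreover obtain w :: 'w where "w \<noteq> 0"
      using assms(2) by (auto simp: graded_simple_def)
    ultimately have "|UNIV :: 'k set| \<le>o W.cdim"
      by (rule \<theta>.card_field_le_cdim)
    then show False
      using assms(3) not_ordLess_ordLeq by blast
  qed
qed

end
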